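(* Let $k$ be a field and let $R$ be a filter of a finite poset $S$. For an $S$-space $\mathbf U=(U,U(s))_{s\in S}$ and an $R$-space $\mathbf V=(V,V(r))_{r\in R}$, let $g:\mathrm{res}^S_R\mathbf U\to\mathbf V$ be a morphism in $R\text{-sp}$ given by a $k$-linear map $g:U\to V$. Set $\mathbf V^g=(Y,Y(s))_{s\in S}$ where $Y=V$, $Y(r)=V(r)$ for all $r\in R$, and $Y(t)=g(U(t))$ for all $t\in S\setminus R$. (a) $\mathbf V^g$ is an $S$-space, and the linear map $g:U\to V$ gives a morphism $\check g:\mathbf U\to\mathbf V^g$ in $S\text{-sp}$ satisfying $g=\mathrm{res}^S_R\check g$. Moreover, $g$ is a proper morphism (respectively, an isomorphism) if and only if so is $\check g$. (b) Let $\mathbf X=(X,X(s))_{s\in S}\in S\text{-sp}$, $\mathbf Z=(Z,Z(r))_{r\in R}\in R\text{-sp}$, and let $h:\mathrm{res}^S_R\mathbf X\to\mathbf Z$ and $\alpha:\mathbf V\to\mathbf Z$ in $R\text{-sp}$ and $\beta:\mathbf U\to\mathbf X$ in $S\text{-sp}$ be morphisms, given by $k$-linear maps denoted by the same letters, such that $\alpha g=h(\mathrm{res}^S_R\beta)$. Then the linear map $\alpha:V\to Z$ gives a morphism $\alpha':\mathbf V^g\to\mathbf Z^h$ in $S\text{-sp}$ satisfying $\alpha=\mathrm{res}^S_R\alpha'$ and $\check h\beta=\alpha'\check g$. In particular, the functor $\mathrm{res}^S_R$ is left quasi full. (c) In the setting of (b), suppose $\beta$ is an isomorphism. Then $\mathbf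 Z^h=\mathbf Z^\alpha$ and $\alpha'=\check\alpha:\mathbf V^g\to\mathbf Z^\alpha$, where $\mathbf Z^\alpha$ and $\check\alpha$ are obtained by applying the construction to $\alpha:\mathrm{res}^S_R\mathbf V^g=\mathbf V\to\mathbf Z$. (d) The morphism $g$ is left minimal if and only if $\check g$ is left minimal. (e) If $J$ is an ideal of $S$ and $\mathbf U\cong\mathrm{coind}^S_J\mathbf W$ for some $\mathbf W\in J\text{-sp}$, then the $S$-space $\mathbf V^g=(Y,Y(s))_{s\in S}$ satisfies $Y(s)\supseteq\mathrm{Im}\, g$ for all $s\in R\setminus J$, and $Y(s)=\mathrm{Im}\, g$ for all $s\in S\setminus[R\cup J]$.
   Context: For a finite poset $S$, an $S$-space is a family $\mathbf V=(V,V(s))_{s\in S}$ where $V$ is a finite dimensional $k$-vector space (the ambient space), each $V(s)$ is a subspace of $V$, and $s\le t$ implies $V(s)\subseteq V(t)$. A morphism $f:(U,U(s))\to(V,V(s))$ is a $k$-linear map $f:U\to V$ with $f(U(s))\subseteq V(s)$ for all $s$. The category of $S$-spaces is $S\text{-sp}$. A morphism $f:\mathbf U\to\mathbf V$ is proper if $f(U(s))=V(s)\cap f(U)$ for all $s\in S$; it is left minimal if every morphism $h:\mathbf V\to\mathbf V$ with $f=hf$ is an automorphism. A subset $F\subseteq S$ is a filter if $t\in F$, $t\le s$ imply $s\in F$; $I\subseteq S$ is an ideal if $t\in I$, $s\le t$ imply $s\in I$. Subsets of a poset carry the induced order. For $R\subseteq S$: $\mathrm{res}^S_R:S\text{-sp}\to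 R\text{-sp}$ sends $(V,V(s))_{s\in S}$ to $(V,V(r))_{r\in R}$; $\mathrm{coind}^S_R:R\text{-sp}\to S\text{-sp}$ sends $(V,V(r))_{r\in R}$ to $(V,X(s))_{s\in S}$ with $X(s)=\bigcap_{r\in R,\,s\le r}V(r)$ (equal to $V$ if there is no such $r$). On morphisms both keep the underlying linear map. A functor $F:\mathfrak A\to\mathfrak B$ is left quasi full if for all objects $u,v,x,z$ of $\mathfrak A$, every morphism $\beta:u\to x$ in $\mathfrak A$, and all morphisms $g:Fu\to Fv$, $h:Fx\to Fz$, $\alpha:Fv\to Fz$ in $\mathfrak B$ with $\alpha g=h(F\beta)$, there exist morphisms $g':u\to v'$, $h':x\to z'$, $\alpha':v'\to z'$ in $\mathfrak A$ with $g=Fg'$, $h=Fh'$, $\alpha=F\alpha'$ and $\alpha'g'=h'\beta$ (in particular $Fv'=Fv$, $Fz'=Fz$). *)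

theory Defs
  imports "Jordan_Normal_Form.Missing_VectorSpace"
begin

section \<open>Categories and left quasi full functors\<close>

record ('o, 'm) cat =
  Ob :: "'o set"
  Hom :: "'o \<Rightarrow> 'o \<Rightarrow> 'm set"
  Comp :: "'m \<Rightarrow> 'm \<Rightarrow> 'm"  \<comment> \<open>\<open>Comp C g f\<close> is \<open>f\<close> followed by \<open>g\<close>\<close>
  Ident :: "'o \<Rightarrow> 'm"

locale category =
  fixes C :: "('o, 'm) cat"
  assumes hom_disjoint:
      "\<lbrakk>a \<in> Ob C; b \<in> Ob C; a' \<in> Ob C; b' \<in> Ob C; f \<in> Hom C a b; f \<in> Hom C a' b'\<rbrakk>
        \<Longrightarrow> a = a' \<and> b = b'"
    and comp_hom:
      "\<lbrakk>a \<in> Ob C; b \<in> Ob C; c \<in> Ob C; f \<in> Hom C a b; g \<in> Hom C b c\<rbrakk> \<Longrightarrow> Comp C g f \<in> Hom C a c"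
    and comp_assoc:
      "\<lbrakk>a \<in> Ob C; b \<in> Ob C; c \<in> Ob C; d \<in> Ob C; f \<in> Hom C a b; g \<in> Hom C b c; h \<in> Hom C c d\<rbrakk>
        \<Longrightarrow> Comp C h (Comp C g f) = Comp C (Comp C h g) f"
    and ident_hom: "a \<in> Ob C \<Longrightarrow> Ident C a \<in> Hom C a a"
    and comp_ident_right: "\<lbrakk>a \<in> Ob C; b \<in> Ob C; f \<in> Hom C a b\<rbrakk> \<Longrightarrow> Comp C f (Ident C a) = f"
    and comp_ident_left: "\<lbrakk>a \<in> Ob C; b \<in> Ob C; f \<in> Hom C a b\<rbrakk> \<Longrightarrow> Comp C (Ident C b) f = f"

definition isomorphism :: "('o, 'm) cat \<Rightarrow> 'o \<Rightarrow> 'o \<Rightarrow> 'm \<Rightarrow> bool" where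
  "isomorphism C a b f \<longleftrightarrow>
     f \<in> Hom C a b \<and> (\<exists>g \<in> Hom C b a. Comp C g f = Ident C a \<and> Comp C f g = Ident C b)"

definition isomorphic :: "('o, 'm) cat \<Rightarrow> 'o \<Rightarrow> 'o \<Rightarrow> bool" where
  "isomorphic C a b \<longleftrightarrow> (\<exists>f. isomorphism C a b f)"

text \<open>Left minimality of a morphism \<open>f\<close> with codomain \<open>v\<close>.\<close>

definition left_minimal :: "('o, 'm) cat \<Rightarrow> 'o \<Rightarrow> 'm \<Rightarrow> bool" where
  "left_minimal C v f \<longleftrightarrow> (\<forall>h \<in> Hom C v v. f = Comp C h f \<longrightarrow> isomorphism C v v h)"

record ('o, 'm, 'p, 'n) functor_data =
  obmap :: "'o \<Rightarrow> 'p"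
  armap :: "'m \<Rightarrow> 'n"

locale cat_functor = A: category A + B: category B
  for A :: "('o, 'm) cat" and B :: "('p, 'n) cat" +
  fixes F :: "('o, 'm, 'p, 'n) functor_data"
  assumes obmap_Ob: "a \<in> Ob A \<Longrightarrow> obmap F a \<in> Ob B"
    and armap_hom:
      "\<lbrakk>a \<in> Ob A; b \<in> Ob A; f \<in> Hom A a b\<rbrakk> \<Longrightarrow> armap F f \<in> Hom B (obmap F a) (obmap F b)"
    and armap_comp:
      "\<lbrakk>a \<in> Ob A; b \<in> Ob A; c \<in> Ob A; f \<in> Hom A a b; g \<in> Hom A b c\<rbrakk>
        \<Longrightarrow> armap F (Comp A g f) = Comp B (armap F g) (armap F f)"
    and armap_ident: "a \<in> Ob A \<Longrightarrow> armap F (Ident A a) = Ident B (obmap F a)"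

definition left_quasi_full ::
  "('o, 'm) cat \<Rightarrow> ('p, 'n) cat \<Rightarrow> ('o, 'm, 'p, 'n) functor_data \<Rightarrow> bool" where
  "left_quasi_full A B F \<longleftrightarrow> cat_functor A B F \<and>
     (\<forall>u \<in> Ob A. \<forall>v \<in> Ob A. \<forall>x \<in> Ob A. \<forall>z \<in> Ob A.
      \<forall>\<beta> \<in> Hom A u x.
      \<forall>g \<in> Hom B (obmap F u) (obmap F v).
      \<forall>h \<in> Hom B (obmap F x) (obmap F z).
      \<forall>\<alpha> \<in> Hom B (obmap F v) (obmap F z).
        Comp B \<alpha> g = Comp B h (armap F \<beta>) \<longrightarrow>
        (\<exists>v' \<in> Ob A. \<exists>z' \<in> Ob A.
           obmap F v' = obmap F v \<and> obmap F z' = obmap F z \<and>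
           (\<exists>g' \<in> Hom A u v'. \<exists>h' \<in> Hom A x z'. \<exists>\<alpha>' \<in> Hom A v' z'.
              g = armap F g' \<and> h = armap F h' \<and> \<alpha> = armap F \<alpha>' \<and>
              Comp A \<alpha>' g' = Comp A h' \<beta>)))"


section \<open>Finite posets\<close>

text \<open>A finite poset is a finite subset of a partially ordered type with the induced order.\<close>

definition poset_filter :: "'s::order set \<Rightarrow> 's set \<Rightarrow> bool" where
  "poset_filter F S \<longleftrightarrow> F \<subseteq> S \<and> (\<forall>t \<in> F. \<forall>s \<in> S. t \<le> s \<longrightarrow> s \<in> F)"

definition poset_ideal :: "'s::order set \<Rightarrow> 's set \<Rightarrow> bool" where
  "poset_ideal I S \<longleftrightarrow> I \<subseteq> S \<and> (\<forall>t \<in> I. \<forall>s \<in> S. s \<le> t \<longrightarrow> s \<in> I)"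


section \<open>The category of S-spaces\<close>

record ('k, 'v, 's) sspace =
  ambient :: "('k, 'v) module"
  sub :: "'s \<Rightarrow> 'v set"

text \<open>
  A morphism carries its domain and codomain. Families \<open>sub\<close> and linear maps \<open>Map\<close> are
  extensional (\<open>undefined\<close> off their domains), so that equality of objects and of morphisms
  is HOL equality.
\<close>

record ('k, 'v, 's) sspace_mor =
  Dom :: "('k, 'v, 's) sspace"
  Cod :: "('k, 'v, 's) sspace"
  Map :: "'v \<Rightarrow> 'v"

abbreviation space :: "('k, 'v, 's) sspace \<Rightarrow> 'v set" where
  "space V \<equiv> carrier (ambient V)"

definition is_sspace :: "('k, 'e) ring_scheme \<Rightarrow> 's::order set \<Rightarrow> ('k, 'v, 's) sspace \<Rightarrow> bool" where
  "is_sspace K S V \<longleftrightarrow>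
     vectorspace K (ambient V) \<and> vectorspace.fin_dim K (ambient V) \<and>
     sub V \<in> extensional S \<and>
     (\<forall>s \<in> S. VectorSpace.subspace K (sub V s) (ambient V)) \<and>
     (\<forall>s \<in> S. \<forall>t \<in> S. s \<le> t \<longrightarrow> sub V s \<subseteq> sub V t)"

definition sspace_hom ::
  "('k, 'e) ring_scheme \<Rightarrow> 's::order set \<Rightarrow> ('k, 'v, 's) sspace \<Rightarrow> ('k, 'v, 's) sspace
    \<Rightarrow> ('k, 'v, 's) sspace_mor set" where
  "sspace_hom K S U V =
     {f. Dom f = U \<and> Cod f = V \<and>
         Map f \<in> extensional (space U) \<and> linear_map K (ambient U) (ambient V) (Map f) \<and>
         (\<forall>s \<in> S. Map f ` sub U s \<subseteq> sub V s)}"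

definition sspace_cat ::
  "('k, 'e) ring_scheme \<Rightarrow> 's::order set \<Rightarrow> (('k, 'v, 's) sspace, ('k, 'v, 's) sspace_mor) cat" where
  "sspace_cat K S =
     \<lparr>Ob = {V. is_sspace K S V},
      Hom = sspace_hom K S,
      Comp = (\<lambda>g f. \<lparr>Dom = Dom f, Cod = Cod g, Map = compose (space (Dom f)) (Map g) (Map f)\<rparr>),
      Ident = (\<lambda>V. \<lparr>Dom = V, Cod = V, Map = (\<lambda>v \<in> space V. v)\<rparr>)\<rparr>"

definition proper :: "'s set \<Rightarrow> ('k, 'v, 's) sspace_mor \<Rightarrow> bool" where
  "proper S f \<longleftrightarrow>
     (\<forall>s \<in> S. Map f ` sub (Dom f) s = sub (Cod f) s \<inter> Map f ` space (Dom f))"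


section \<open>Restriction, coinduction and the space \<open>V\<^sup>g\<close>\<close>

definition res_ob :: "'s set \<Rightarrow> ('k, 'v, 's) sspace \<Rightarrow> ('k, 'v, 's) sspace" where
  "res_ob R V = \<lparr>ambient = ambient V, sub = restrict (sub V) R\<rparr>"

definition res ::
  "'s set \<Rightarrow> (('k, 'v, 's) sspace, ('k, 'v, 's) sspace_mor,
              ('k, 'v, 's) sspace, ('k, 'v, 's) sspace_mor) functor_data" where
  "res R =
     \<lparr>obmap = res_ob R,
      armap = (\<lambda>f. \<lparr>Dom = res_ob R (Dom f), Cod = res_ob R (Cod f), Map = Map f\<rparr>)\<rparr>"

definition coind_ob :: "'s::order set \<Rightarrow> 's set \<Rightarrow> ('k, 'v, 's) sspace \<Rightarrow> ('k, 'v, 's) sspace" where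
  "coind_ob S R V =
     \<lparr>ambient = ambient V,
      sub = (\<lambda>s \<in> S. if \<exists>r \<in> R. s \<le> r then \<Inter>r \<in> {r \<in> R. s \<le> r}. sub V r else space V)\<rparr>"

text \<open>
  For \<open>g : res U \<rightarrow> V\<close>, the object \<open>V\<^sup>g\<close> and the morphism \<open>U \<rightarrow> V\<^sup>g\<close> given by the same
  linear map. The \<open>S\<close>-space \<open>U\<close> is a separate argument, since \<open>Dom g\<close> only records
  its restriction to \<open>R\<close>.
\<close>

definition up_space ::
  "'s set \<Rightarrow> 's set \<Rightarrow> ('k, 'v, 's) sspace \<Rightarrow> ('k, 'v, 's) sspace_mor \<Rightarrow> ('k, 'v, 's) sspace" where
  "up_space S R U g =
     \<lparr>ambient = ambient (Cod g),
      sub = (\<lambda>s \<in> S. if s \<in> R then sub (Cod g) s else Map g ` sub U s)\<rparr>"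

definition up_mor ::
  "'s set \<Rightarrow> 's set \<Rightarrow> ('k, 'v, 's) sspace \<Rightarrow> ('k, 'v, 's) sspace_mor \<Rightarrow> ('k, 'v, 's) sspace_mor" where
  "up_mor S R U g = \<lparr>Dom = U, Cod = up_space S R U g, Map = Map g\<rparr>"

end

theory Submission
  imports Defs
begin

text \<open>
  Every subspace of \<open>V\<^sup>g\<close> indexed outside the filter \<open>R\<close> is an image under \<open>g\<close>, hence a linear map
  that fits into a commutative square automatically respects these subspaces. The same remark
  reduces isomorphism questions over \<open>S\<close> to \<open>R\<close>: a morphism of \<open>S\<close>-spaces whose restriction
  to \<open>R\<close> is invertible is invertible as soon as it is onto on the subspaces indexed by
  \<open>S - R\<close>. This gives both the isomorphism part of (a) and (d).
\<close>

section \<open>Linear maps\<close>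

text \<open>Flattens the locale predicate to membership in \<open>module_hom\<close>, so that
  linearity of composites and identities becomes a matter of simplification.\<close>

lemma linear_map_iff:
  "linear_map K V W T \<longleftrightarrow> vectorspace K V \<and> vectorspace K W \<and> T \<in> module_hom K V W"
  by (auto simp: linear_map_def mod_hom_def mod_hom_axioms_def vectorspace_def)

lemma linear_map_closed: "linear_map K V W T \<Longrightarrow> v \<in> carrier V \<Longrightarrow> T v \<in> carrier W"
  by (auto simp: linear_map_iff module_hom_def)

lemma linear_map_compose:
  assumes "linear_map K U V f" "linear_map K V W g"
  shows "linear_map K U W (compose (carrier U) g f)"
proof -
  from assms(1) interpret linear_map K U V f .
  show ?thesis
    using assms by (auto simp: linear_map_iff module_hom_def compose_def Pi_def)
qed

lemma linear_map_ident:
  assumes "vectorspace K V"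
  shows "linear_map K V V (\<lambda>v \<in> carrier V. v)"
proof -
  from assms interpret vectorspace K V .
  show ?thesis
    using assms by (auto simp: linear_map_iff module_hom_def)
qed

lemma subspace_subset: "VectorSpace.subspace K W V \<Longrightarrow> W \<subseteq> carrier V"
  by (auto simp: VectorSpace.subspace_def submodule_def)

text \<open>Needed for the components of \<open>V\<^sup>g\<close> indexed outside \<open>R\<close>,
  which are images of subspaces of \<open>U\<close>.\<close>

lemma subspace_image:
  assumes "linear_map K U V f" "VectorSpace.subspace K W U"
  shows "VectorSpace.subspace K (f ` W) V"
proof -
  from assms(1) interpret linear_map K U V f .
  from assms(2) interpret W: LinearCombinations.submodule K W U
    by (simp add: VectorSpace.subspace_def)
  have WU: "x \<in> carrier U" if "x \<in> W" for x
    using W.subset that by blast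
  have "LinearCombinations.submodule K (f ` W) V"
  proof (rule LinearCombinations.submodule.intro)
    show "module K V" by unfold_locales
    show "f ` W \<subseteq> carrier V"
      using WU by auto
    \<comment> \<open>Additivity, read from right to left, exhibits a sum of images as the image of
      a sum; scalar multiples are treated alike below.\<close>
    show "v \<oplus>\<^bsub>V\<^esub> w \<in> f ` W" if "v \<in> f ` W" "w \<in> f ` W" for v w
      using that WU by (auto simp flip: f_add)
    show "\<zero>\<^bsub>V\<^esub> \<in> f ` W"
      using W.zero_closed f0_is_0 by (metis imageI)
    show "c \<odot>\<^bsub>V\<^esub> v \<in> f ` W" if "c \<in> carrier K" "v \<in> f ` W" for c v
      using that WU by (auto simp flip: f_smult)
  qed
  then show ?thesis
    by (simp add: VectorSpace.subspace_def W.vectorspace_axioms)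
qed

section \<open>The category of S-spaces\<close>

lemma sspace_cat_simps [simp]:
  "V \<in> Ob (sspace_cat K S) \<longleftrightarrow> is_sspace K S V"
  "Hom (sspace_cat K S) = sspace_hom K S"
  "Comp (sspace_cat K S) g f =
     \<lparr>Dom = Dom f, Cod = Cod g, Map = compose (space (Dom f)) (Map g) (Map f)\<rparr>"
  "Ident (sspace_cat K S) V = \<lparr>Dom = V, Cod = V, Map = (\<lambda>v \<in> space V. v)\<rparr>"
  by (simp_all add: sspace_cat_def)

lemma res_simps [simp]:
  "obmap (res R) = res_ob R"
  "armap (res R) f = \<lparr>Dom = res_ob R (Dom f), Cod = res_ob R (Cod f), Map = Map f\<rparr>"
  by (simp_all add: res_def)

lemma res_ob_simps [simp]:
  "ambient (res_ob R V) = ambient V"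
  "s \<in> R \<Longrightarrow> sub (res_ob R V) s = sub V s"
  by (simp_all add: res_ob_def)

lemma sub_subset_space: "is_sspace K S V \<Longrightarrow> s \<in> S \<Longrightarrow> sub V s \<subseteq> space V"
  unfolding is_sspace_def by (blast dest: subspace_subset)

lemma sspace_homD:
  assumes "f \<in> sspace_hom K S U V"
  shows "Dom f = U" "Cod f = V" "Map f \<in> extensional (space U)"
    "linear_map K (ambient U) (ambient V) (Map f)"
    "\<And>s. s \<in> S \<Longrightarrow> Map f ` sub U s \<subseteq> sub V s"
    "\<And>u. u \<in> space U \<Longrightarrow> Map f u \<in> space V"
  using assms by (auto simp: sspace_hom_def linear_map_closed)

lemma category_sspace_cat: "category (sspace_cat K S)"
proof
  fix a b c f g
  assume ob: "a \<in> Ob (sspace_cat K S)" "b \<in> Ob (sspace_cat K S)" "c \<in> Ob (sspace_cat K S)"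
    and f: "f \<in> Hom (sspace_cat K S) a b" and g: "g \<in> Hom (sspace_cat K S) b c"
  \<comment> \<open>\<open>compose\<close> is the true composite only on \<open>space a\<close>, so
    the inclusion of \<open>sub a s\<close> in \<open>space a\<close> enters here.\<close>
  have "compose (space a) (Map g) (Map f) ` sub a s \<subseteq> sub c s" if "s \<in> S" for s
    using that f g sub_subset_space[of K S a s] ob(1)
    by (fastforce simp: compose_def dest!: sspace_homD(5))
  then show "Comp (sspace_cat K S) g f \<in> Hom (sspace_cat K S) a c"
    using f g by (auto simp: sspace_hom_def intro: linear_map_compose)
next
  fix a assume "a \<in> Ob (sspace_cat K S)"
  then show "Ident (sspace_cat K S) a \<in> Hom (sspace_cat K S) a a"
    using sub_subset_space[of K S a]
    by (auto simp: sspace_hom_def is_sspace_def intro: linear_map_ident)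
next
  fix a b c d f g h
  assume "f \<in> Hom (sspace_cat K S) a b"
  then show "Comp (sspace_cat K S) h (Comp (sspace_cat K S) g f) =
      Comp (sspace_cat K S) (Comp (sspace_cat K S) h g) f" if "g \<in> Hom (sspace_cat K S) b c"
    using that by (auto simp: compose_def fun_eq_iff restrict_def dest: sspace_homD)
next
  fix a b f
  assume "f \<in> Hom (sspace_cat K S) a b"
  then have f: "Dom f = a" "Cod f = b" "Map f \<in> extensional (space a)"
    "\<And>u. u \<in> space a \<Longrightarrow> Map f u \<in> space b"
    by (auto dest: sspace_homD)
  \<comment> \<open>Off \<open>space a\<close> both sides are \<open>undefined\<close>, because
    \<open>Map f\<close> is extensional.\<close>
  have "compose (space a) (Map f) (\<lambda>v \<in> space a. v) = Map f"
    "compose (space a) (\<lambda>v \<in> space b. v) (Map f) = Map f"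
    using f(3,4) by (auto simp: compose_def fun_eq_iff restrict_def extensional_def)
  with f show "Comp (sspace_cat K S) f (Ident (sspace_cat K S) a) = f"
    and "Comp (sspace_cat K S) (Ident (sspace_cat K S) b) f = f"
    by simp_all
qed (auto dest: sspace_homD)

section \<open>The restriction functor\<close>

lemma is_sspace_res_ob: "R \<subseteq> S \<Longrightarrow> is_sspace K S V \<Longrightarrow> is_sspace K R (res_ob R V)"
  by (simp add: is_sspace_def res_ob_def subset_iff) blast

lemma cat_functor_res:
  assumes "R \<subseteq> S"
  shows "cat_functor (sspace_cat K S) (sspace_cat K R) (res R)"
proof -
  interpret S: category "sspace_cat K S" by (rule category_sspace_cat)
  interpret R: category "sspace_cat K R" by (rule category_sspace_cat)
  show ?thesis
    using assms by unfold_locales (auto simp: is_sspace_res_ob, auto simp: sspace_hom_def)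
qed

lemma (in cat_functor) isomorphism_armap:
  assumes ob: "a \<in> Ob A" "b \<in> Ob A" and "isomorphism A a b f"
  shows "isomorphism B (obmap F a) (obmap F b) (armap F f)"
proof -
  from assms obtain g where "f \<in> Hom A a b" "g \<in> Hom A b a"
    "Comp A g f = Ident A a" "Comp A f g = Ident A b"
    by (auto simp: isomorphism_def)
  then show ?thesis
    using ob armap_hom armap_comp armap_ident unfolding isomorphism_def by metis
qed

section \<open>Isomorphisms of S-spaces\<close>

lemma sspace_isomorphismE:
  assumes "isomorphism (sspace_cat K S) U V f"
  obtains g where "f \<in> sspace_hom K S U V" "g \<in> sspace_hom K S V U"
    "\<And>u. u \<in> space U \<Longrightarrow> Map g (Map f u) = u" "\<And>v. v \<in> space V \<Longrightarrow> Map f (Map g v) = v"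
proof -
  from assms obtain g where fg: "f \<in> sspace_hom K S U V" "g \<in> sspace_hom K S V U"
    and "Comp (sspace_cat K S) g f = Ident (sspace_cat K S) U"
    and "Comp (sspace_cat K S) f g = Ident (sspace_cat K S) V"
    by (auto simp: isomorphism_def)
  then have "compose (space U) (Map g) (Map f) = (\<lambda>u \<in> space U. u)"
    "compose (space V) (Map f) (Map g) = (\<lambda>v \<in> space V. v)"
    by (auto dest: sspace_homD)
  then show thesis
    by (intro that[OF fg]) (metis compose_eq restrict_apply')+
qed

text \<open>The inverse \<open>g\<close> is itself a morphism, so any \<open>v\<close> in
  \<open>sub V s\<close> is the image of \<open>Map g v\<close>, which lies in
  \<open>sub U s\<close>. Bijectivity of the linear map alone would not give this.\<close>

lemma sspace_isomorphism_image_sub: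
  assumes "isomorphism (sspace_cat K S) U V f" "is_sspace K S V" "s \<in> S"
  shows "Map f ` sub U s = sub V s"
proof -
  obtain g where f: "f \<in> sspace_hom K S U V" and g: "g \<in> sspace_hom K S V U"
    and fg: "\<And>v. v \<in> space V \<Longrightarrow> Map f (Map g v) = v"
    by (rule sspace_isomorphismE[OF assms(1)]) blast
  have "v \<in> Map f ` sub U s" if "v \<in> sub V s" for v
    using that fg sspace_homD(5)[OF g assms(3)] sub_subset_space[OF assms(2,3)]
    by (metis image_subset_iff imageI subsetD)
  then show ?thesis
    using sspace_homD(5)[OF f assms(3)] by blast
qed

text \<open>The inverse over \<open>R\<close> already supplies the linear map \<open>Map k\<close>;
  only its compatibility with the subspaces outside \<open>R\<close> is open. There a vector of
  \<open>sub V s\<close> is \<open>Map f u\<close> with \<open>u\<close> in \<open>sub U s\<close>,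
  and \<open>Map k\<close> sends it back to \<open>u\<close>.\<close>

lemma isomorphism_if_isomorphism_res:
  assumes "is_sspace K S U" "is_sspace K S V" "f \<in> sspace_hom K S U V"
    and iso: "isomorphism (sspace_cat K R) (res_ob R U) (res_ob R V) (armap (res R) f)"
    and onto: "\<And>s. s \<in> S - R \<Longrightarrow> sub V s \<subseteq> Map f ` sub U s"
  shows "isomorphism (sspace_cat K S) U V f"
proof -
  obtain k where k: "k \<in> sspace_hom K R (res_ob R V) (res_ob R U)"
    and kf: "\<And>u. u \<in> space U \<Longrightarrow> Map k (Map f u) = u"
    and fk: "\<And>v. v \<in> space V \<Longrightarrow> Map f (Map k v) = v"
    by (rule sspace_isomorphismE[OF iso]) auto
  define k' where "k' = \<lparr>Dom = V, Cod = U, Map = Map k\<rparr>"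
  have "Map k ` sub V s \<subseteq> sub U s" if "s \<in> S" for s
  proof (cases "s \<in> R")
    case True
    then show ?thesis using sspace_homD(5)[OF k True] by simp
  next
    case False
    then show ?thesis
      using onto[of s] kf sub_subset_space[OF assms(1) that] that by fastforce
  qed
  then have k': "k' \<in> sspace_hom K S V U"
    using k by (auto simp: k'_def sspace_hom_def)
  have "Comp (sspace_cat K S) k' f = Ident (sspace_cat K S) U"
    "Comp (sspace_cat K S) f k' = Ident (sspace_cat K S) V"
    using kf fk sspace_homD(1,2)[OF assms(3)]
    by (auto simp: k'_def compose_def fun_eq_iff)
  then show ?thesis
    using assms(3) k' by (auto simp: isomorphism_def)
qed

section \<open>The space \<open>V\<^sup>g\<close>\<close>

lemma up_space_simps [simp]:
  "ambient (up_space S R U g) = ambient (Cod g)"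
  "s \<in> S \<Longrightarrow> s \<in> R \<Longrightarrow> sub (up_space S R U g) s = sub (Cod g) s"
  "s \<in> S \<Longrightarrow> s \<notin> R \<Longrightarrow> sub (up_space S R U g) s = Map g ` sub U s"
  by (simp_all add: up_space_def)

lemma up_mor_simps [simp]:
  "Dom (up_mor S R U g) = U"
  "Cod (up_mor S R U g) = up_space S R U g"
  "Map (up_mor S R U g) = Map g"
  by (simp_all add: up_mor_def)

text \<open>A genuine equality of objects, not just an isomorphism: both families are extensional on
  \<open>R\<close>.\<close>

lemma res_up_space:
  assumes "R \<subseteq> S" "is_sspace K R V" "g \<in> sspace_hom K R (res_ob R U) V"
  shows "res_ob R (up_space S R U g) = V"
proof -
  have "restrict (sub (up_space S R U g)) R = sub V"
    using assms sspace_homD(2)[OF assms(3)]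
    by (auto simp: is_sspace_def fun_eq_iff restrict_def extensional_def up_space_def)
  then show ?thesis
    using sspace_homD(2)[OF assms(3)] by (simp add: res_ob_def)
qed

lemma res_up_mor:
  assumes "R \<subseteq> S" "is_sspace K R V" "g \<in> sspace_hom K R (res_ob R U) V"
  shows "armap (res R) (up_mor S R U g) = g"
  using res_up_space[OF assms] sspace_homD(1,2)[OF assms(3)] by simp

text \<open>For comparable indices \<open>s \<le> t\<close> the filter property excludes
  \<open>s\<close> in \<open>R\<close> with \<open>t\<close> outside, the one case where nothing
  relates \<open>V(s)\<close> to the image of \<open>U(t)\<close>. If only \<open>t\<close> lies in
  \<open>R\<close>, the image of \<open>U(s)\<close> is contained in that of \<open>U(t)\<close>,
  hence in \<open>V(t)\<close> since \<open>g\<close> is a morphism over \<open>R\<close>.\<close>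

lemma is_sspace_up_space:
  assumes R: "poset_filter R S" and U: "is_sspace K S U" and V: "is_sspace K R V"
    and g: "g \<in> sspace_hom K R (res_ob R U) V"
  shows "is_sspace K S (up_space S R U g)"
proof -
  have up: "\<And>s t. t \<in> R \<Longrightarrow> s \<in> S \<Longrightarrow> t \<le> s \<Longrightarrow> s \<in> R"
    using R by (auto simp: poset_filter_def)
  note gD = sspace_homD[OF g]
  have lin: "linear_map K (ambient U) (ambient V) (Map g)"
    using gD(4) by simp
  have "sub (up_space S R U g) s \<subseteq> sub (up_space S R U g) t"
    if "s \<in> S" "t \<in> S" "s \<le> t" for s t
  proof (cases "s \<in> R")
    case True
    with up that have "t \<in> R" by blast
    with True that V show ?thesis by (simp add: gD(2) is_sspace_def)
  next
    case False
    have *: "Map g ` sub U s \<subseteq> Map g ` sub U t"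
      using U that unfolding is_sspace_def by blast
    show ?thesis
    proof (cases "t \<in> R")
      case True
      then show ?thesis using * gD(5)[OF True] False that by (auto simp: gD(2))
    next
      case F: False
      then show ?thesis using * False that by simp
    qed
  qed
  moreover have "VectorSpace.subspace K (sub (up_space S R U g) s) (ambient V)" if "s \<in> S" for s
  proof (cases "s \<in> R")
    case True
    then show ?thesis using V that by (simp add: is_sspace_def gD(2))
  next
    case False
    then show ?thesis using U that lin by (auto simp: is_sspace_def intro: subspace_image)
  qed
  ultimately show ?thesis
    using V by (simp add: is_sspace_def gD(2)) (simp add: up_space_def)
qed

lemma up_mor_hom:
  assumes "g \<in> sspace_hom K R (res_ob R U) V"
  shows "up_mor S R U g \<in> sspace_hom K S U (up_space S R U g)"
proof -
  have "Map g ` sub U s \<subseteq> sub (up_space S R U g) s" if "s \<in> S" for s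
    using that sspace_homD(2,5)[OF assms] by (cases "s \<in> R") auto
  then show ?thesis
    using assms by (auto simp: sspace_hom_def)
qed

text \<open>Outside \<open>R\<close> the condition is automatic: the component is the image of
  \<open>U(s)\<close>, which is contained in the image of \<open>U\<close>.\<close>

lemma proper_up_mor_iff:
  assumes "R \<subseteq> S" "is_sspace K S U" "g \<in> sspace_hom K R (res_ob R U) V"
  shows "proper S (up_mor S R U g) \<longleftrightarrow> proper R g"
proof -
  note D = sspace_homD(1,2)[OF assms(3)]
  have sub: "Map g ` sub U s \<subseteq> Map g ` space U" if "s \<in> S" for s
    using sub_subset_space[OF assms(2) that] by (rule image_mono)
  have "proper S (up_mor S R U g) \<longleftrightarrow>
      (\<forall>s \<in> S. Map g ` sub U s = sub (up_space S R U g) s \<inter> Map g ` space U)"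
    by (simp add: proper_def)
  also have "\<dots> \<longleftrightarrow> (\<forall>s \<in> S. s \<in> R \<longrightarrow> Map g ` sub U s = sub V s \<inter> Map g ` space U)"
  proof (rule ball_cong[OF refl])
    show "(Map g ` sub U s = sub (up_space S R U g) s \<inter> Map g ` space U) \<longleftrightarrow>
        (s \<in> R \<longrightarrow> Map g ` sub U s = sub V s \<inter> Map g ` space U)" if "s \<in> S" for s
      using that sub[OF that] D(2) by (cases "s \<in> R") (simp_all add: Int_absorb2)
  qed
  also have "\<dots> \<longleftrightarrow> proper R g"
    using assms(1) by (simp add: proper_def D) (meson subsetD)
  finally show ?thesis .
qed

text \<open>One direction is functoriality of \<open>res R\<close>. In the other, surjectivity onto
  the components outside \<open>R\<close> holds by construction of \<open>up_space\<close>.\<close>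

lemma isomorphism_up_mor_iff:
  assumes R: "poset_filter R S" and U: "is_sspace K S U" and V: "is_sspace K R V"
    and g: "g \<in> sspace_hom K R (res_ob R U) V"
  shows "isomorphism (sspace_cat K S) U (up_space S R U g) (up_mor S R U g) \<longleftrightarrow>
    isomorphism (sspace_cat K R) (res_ob R U) V g"
proof -
  have RS: "R \<subseteq> S" using R by (simp add: poset_filter_def)
  note W = is_sspace_up_space[OF assms]
  note rs = res_up_space[OF RS V g] and rm = res_up_mor[OF RS V g]
  interpret cat_functor "sspace_cat K S" "sspace_cat K R" "res R"
    by (rule cat_functor_res[OF RS])
  show ?thesis
  proof
    assume "isomorphism (sspace_cat K S) U (up_space S R U g) (up_mor S R U g)"
    from isomorphism_armap[OF _ _ this] show "isomorphism (sspace_cat K R) (res_ob R U) V g"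
      unfolding rm using U W rs by simp
  next
    assume "isomorphism (sspace_cat K R) (res_ob R U) V g"
    then show "isomorphism (sspace_cat K S) U (up_space S R U g) (up_mor S R U g)"
      by (intro isomorphism_if_isomorphism_res[OF U W up_mor_hom[OF g], of R]) (simp_all only: rs rm, auto)
  qed
qed

section \<open>Commutative squares and left quasi fullness\<close>

lemma up_space_square:
  assumes U: "is_sspace K S U" and g: "g \<in> sspace_hom K R (res_ob R U) V"
    and h: "h \<in> sspace_hom K R (res_ob R X) Z" and \<alpha>: "\<alpha> \<in> sspace_hom K R V Z"
    and \<beta>: "\<beta> \<in> sspace_hom K S U X"
    and eq: "Comp (sspace_cat K R) \<alpha> g = Comp (sspace_cat K R) h (armap (res R) \<beta>)"
  defines "\<alpha>' \<equiv> \<lparr>Dom = up_space S R U g, Cod = up_space S R X h, Map = Map \<alpha>\<rparr>"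
  shows "u \<in> space U \<Longrightarrow> Map \<alpha> (Map g u) = Map h (Map \<beta> u)"
    and "\<alpha>' \<in> sspace_hom K S (up_space S R U g) (up_space S R X h)"
    and "Comp (sspace_cat K S) (up_mor S R X h) \<beta> = Comp (sspace_cat K S) \<alpha>' (up_mor S R U g)"
proof -
  note D [simp] = sspace_homD(1,2)[OF g] sspace_homD(1,2)[OF h] sspace_homD(1,2)[OF \<alpha>]
    sspace_homD(1,2)[OF \<beta>]
  have maps: "compose (space U) (Map \<alpha>) (Map g) = compose (space U) (Map h) (Map \<beta>)"
    using eq by simp
  show pt: "Map \<alpha> (Map g u) = Map h (Map \<beta> u)" if "u \<in> space U" for u
    using fun_cong[OF maps, of u] that by (simp add: compose_eq)
  have "Map \<alpha> ` sub (up_space S R U g) s \<subseteq> sub (up_space S R X h) s" if "s \<in> S" for s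
  proof (cases "s \<in> R")
    case True
    then show ?thesis using that sspace_homD(5)[OF \<alpha>] by simp
  next
    case False
    \<comment> \<open>A vector of the component at \<open>s\<close> has the form
      \<open>Map g u\<close>; commutativity rewrites its image as
      \<open>Map h (Map \<beta> u)\<close>, and \<open>\<beta>\<close> respects the subspaces at
      every index of \<open>S\<close>.\<close>
    have "Map \<alpha> (Map g u) \<in> Map h ` sub X s" if "u \<in> sub U s" for u
    proof -
      have "u \<in> space U" "Map \<beta> u \<in> sub X s"
        using that sub_subset_space[OF U \<open>s \<in> S\<close>] sspace_homD(5)[OF \<beta> \<open>s \<in> S\<close>] by blast+
      then show ?thesis by (simp add: pt)
    qed
    then show ?thesis using False that by auto
  qed
  then show "\<alpha>' \<in> sspace_hom K S (up_space S R U g) (up_space S R X h)"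
    using \<alpha> by (auto simp: sspace_hom_def \<alpha>'_def)
  show "Comp (sspace_cat K S) (up_mor S R X h) \<beta> = Comp (sspace_cat K S) \<alpha>' (up_mor S R U g)"
    using maps by (simp add: \<alpha>'_def)
qed

text \<open>An isomorphism \<open>\<beta>\<close> maps \<open>U(s)\<close> onto \<open>X(s)\<close>,
  so the image of \<open>X(s)\<close> under \<open>h\<close> is that of \<open>U(s)\<close> under
  \<open>h\<close> after \<open>\<beta>\<close>, that is, under \<open>\<alpha>\<close> after
  \<open>g\<close>. At indices in \<open>R\<close> both spaces have the components of
  \<open>Z\<close>.\<close>

lemma up_space_square_iso:
  assumes U: "is_sspace K S U" and X: "is_sspace K S X"
    and g: "g \<in> sspace_hom K R (res_ob R U) V"
    and h: "h \<in> sspace_hom K R (res_ob R X) Z" and \<alpha>: "\<alpha> \<in> sspace_hom K R V Z"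
    and eq: "Comp (sspace_cat K R) \<alpha> g = Comp (sspace_cat K R) h (armap (res R) \<beta>)"
    and \<beta>: "isomorphism (sspace_cat K S) U X \<beta>"
  shows "up_space S R X h = up_space S R (up_space S R U g) \<alpha>"
proof -
  have \<beta>': "\<beta> \<in> sspace_hom K S U X"
    using \<beta> by (simp add: isomorphism_def)
  note pt = up_space_square(1)[OF U g h \<alpha> \<beta>' eq]
  have "Map h ` sub X s = Map \<alpha> ` Map g ` sub U s" if "s \<in> S" for s
    using sspace_isomorphism_image_sub[OF \<beta> X that, symmetric] sub_subset_space[OF U that] pt
    by (auto simp: image_image intro!: image_cong)
  then show ?thesis
    using sspace_homD(2)[OF h] sspace_homD(2)[OF \<alpha>]
    by (auto simp: up_space_def fun_eq_iff restrict_def)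
qed

text \<open>The given \<open>v\<close> and \<open>z\<close> are replaced by the spaces built from
  \<open>g\<close> and \<open>h\<close>, which have the same restrictions to \<open>R\<close>; all
  three lifts keep their linear maps.\<close>

lemma left_quasi_full_res:
  assumes R: "poset_filter R S"
  shows "left_quasi_full (sspace_cat K S)
    (sspace_cat K R :: (('k, 'v, 's::order) sspace, ('k, 'v, 's) sspace_mor) cat) (res R)"
  unfolding left_quasi_full_def
proof (intro conjI ballI impI, goal_cases)
  case 1
  show ?case using R by (intro cat_functor_res) (simp add: poset_filter_def)
next
  case (2 u v x z \<beta> g h \<alpha>)
  have RS: "R \<subseteq> S" using R by (simp add: poset_filter_def)
  have u: "is_sspace K S u" and x: "is_sspace K S x"
    and v: "is_sspace K R (res_ob R v)" and z: "is_sspace K R (res_ob R z)"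
    using 2 RS by (auto intro: is_sspace_res_ob)
  have g: "g \<in> sspace_hom K R (res_ob R u) (res_ob R v)"
    and h: "h \<in> sspace_hom K R (res_ob R x) (res_ob R z)"
    and \<alpha>: "\<alpha> \<in> sspace_hom K R (res_ob R v) (res_ob R z)"
    and \<beta>: "\<beta> \<in> sspace_hom K S u x"
    using 2 by simp_all
  define \<alpha>' where "\<alpha>' = \<lparr>Dom = up_space S R u g, Cod = up_space S R x h, Map = Map \<alpha>\<rparr>"
  note rv = res_up_space[OF RS v g] and rz = res_up_space[OF RS z h]
  show ?case
  proof (rule bexI[of _ "up_space S R u g"], rule bexI[of _ "up_space S R x h"], intro conjI bexI)
    show "obmap (res R) (up_space S R u g) = obmap (res R) v"
      "obmap (res R) (up_space S R x h) = obmap (res R) z"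
      using rv rz by simp_all
    show "g = armap (res R) (up_mor S R u g)" "h = armap (res R) (up_mor S R x h)"
      using res_up_mor[OF RS v g] res_up_mor[OF RS z h] by simp_all
    show "\<alpha> = armap (res R) \<alpha>'"
      using rv rz sspace_homD(1,2)[OF \<alpha>] by (simp add: \<alpha>'_def)
    \<comment> \<open>\<open>2(9)\<close> is the commutativity of the given square.\<close>
    show "Comp (sspace_cat K S) \<alpha>' (up_mor S R u g) = Comp (sspace_cat K S) (up_mor S R x h) \<beta>"
      unfolding \<alpha>'_def using up_space_square(3)[OF u g h \<alpha> \<beta> 2(9)] by (rule sym)
    show "\<alpha>' \<in> Hom (sspace_cat K S) (up_space S R u g) (up_space S R x h)"
      using up_space_square(2)[OF u g h \<alpha> \<beta> 2(9)] by (simp add: \<alpha>'_def)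
  qed (use is_sspace_up_space[OF R u v g] is_sspace_up_space[OF R x z h] up_mor_hom[OF g]
      up_mor_hom[OF h] in simp_all)
qed

section \<open>Left minimality\<close>

lemma left_minimal_up_mor_iff:
  assumes R: "poset_filter R S" and U: "is_sspace K S U" and V: "is_sspace K R V"
    and g: "g \<in> sspace_hom K R (res_ob R U) V"
  shows "left_minimal (sspace_cat K S) (up_space S R U g) (up_mor S R U g) \<longleftrightarrow>
    left_minimal (sspace_cat K R) V g"
proof -
  let ?S = "sspace_cat K S" and ?R = "sspace_cat K R" and ?W = "up_space S R U g"
  have RS: "R \<subseteq> S" using R by (simp add: poset_filter_def)
  note W = is_sspace_up_space[OF assms]
  note rs = res_up_space[OF RS V g] and rm = res_up_mor[OF RS V g] and gu = up_mor_hom[OF g, of S]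
  interpret cat_functor ?S ?R "res R"
    by (rule cat_functor_res[OF RS])
  show ?thesis
  proof
    assume min: "left_minimal ?S ?W (up_mor S R U g)"
    show "left_minimal ?R V g"
      unfolding left_minimal_def
    proof (intro ballI impI)
      fix h assume h: "h \<in> Hom ?R V V" and hg: "g = Comp ?R h g"
      define h' where "h' = \<lparr>Dom = ?W, Cod = ?W, Map = Map h\<rparr>"
      have h_hom: "h \<in> sspace_hom K R V V"
        using h by simp
      have id_hom: "Ident ?S U \<in> sspace_hom K S U U"
        using A.ident_hom[of U] U by simp
      have "Comp ?R g (armap (res R) (Ident ?S U)) = g"
        using B.comp_ident_right[of "res_ob R U" V g] armap_ident[of U] is_sspace_res_ob[OF RS U] U V g
        by simp
      \<comment> \<open>The equation \<open>g = h g\<close> is read as a square whose edge over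
        \<open>S\<close> is the identity of \<open>U\<close>; hence \<open>h\<close> lifts to an
        endomorphism of \<open>?W\<close>.\<close>
      with hg have sq: "Comp ?R h g = Comp ?R g (armap (res R) (Ident ?S U))"
        by simp
      have "h' \<in> sspace_hom K S ?W ?W"
        unfolding h'_def by (rule up_space_square(2)[OF U g g h_hom id_hom sq])
      moreover have "up_mor S R U g = Comp ?S h' (up_mor S R U g)"
        \<comment> \<open>The lifted square turns the right side into \<open>up_mor\<close> after
          the identity of \<open>U\<close>.\<close>
        unfolding h'_def up_space_square(3)[OF U g g h_hom id_hom sq, symmetric]
        by (rule A.comp_ident_right[of U ?W, symmetric]) (simp_all only: sspace_cat_simps(1,2) U W gu)
      ultimately have "isomorphism ?S ?W ?W h'"
        using min unfolding left_minimal_def sspace_cat_simps(2) by blast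
      then have "isomorphism ?R (res_ob R ?W) (res_ob R ?W) (armap (res R) h')"
        using isomorphism_armap[of ?W ?W h'] W by simp
      moreover have "armap (res R) h' = h"
        using rs sspace_homD(1,2)[OF h_hom] by (simp add: h'_def)
      ultimately show "isomorphism ?R V V h"
        by (simp only: rs)
    qed
  next
    assume min: "left_minimal ?R V g"
    show "left_minimal ?S ?W (up_mor S R U g)"
      unfolding left_minimal_def
    proof (intro ballI impI)
      fix h assume "h \<in> Hom ?S ?W ?W" and hg: "up_mor S R U g = Comp ?S h (up_mor S R U g)"
      then have h: "h \<in> sspace_hom K S ?W ?W" by simp
      have "armap (res R) h \<in> Hom ?R V V"
        using armap_hom[of ?W ?W h] W h rs by simp
      moreover have "g = Comp ?R (armap (res R) h) g"
        using armap_comp[of U ?W ?W "up_mor S R U g" h] U W h gu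
        by (simp only: rm hg[symmetric] sspace_cat_simps(1,2))
      ultimately have iso: "isomorphism ?R V V (armap (res R) h)"
        using min by (simp only: left_minimal_def)
      \<comment> \<open>Since \<open>h\<close> fixes the image of \<open>g\<close> pointwise, it
        maps every component outside \<open>R\<close> onto itself, as the isomorphism criterion
        demands.\<close>
      have "Map h (Map g u) = Map g u" if "u \<in> space U" for u
        using arg_cong[OF hg, of "\<lambda>f. Map f u"] that by (simp add: compose_eq)
      then have "Map h ` Map g ` sub U s = Map g ` sub U s" if "s \<in> S" for s
        using sub_subset_space[OF U that] by (auto simp: image_image subset_iff intro!: image_cong)
      then show "isomorphism ?S ?W ?W h"
        by (intro isomorphism_if_isomorphism_res[OF W W h, of R]) (simp_all only: rs iso, simp)
    qed
  qed
qed

section \<open>Coinduced spaces\<close>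

lemma sub_eq_space_if_isomorphic_coind:
  assumes "poset_ideal J S" "is_sspace K S U" "isomorphic (sspace_cat K S) U (coind_ob S J W)"
    and "s \<in> S - J"
  shows "sub U s = space U"
proof -
  obtain f where "isomorphism (sspace_cat K S) U (coind_ob S J W) f"
    using assms(3) by (auto simp: isomorphic_def)
  then obtain k where f: "f \<in> sspace_hom K S U (coind_ob S J W)"
    and k: "k \<in> sspace_hom K S (coind_ob S J W) U"
    and kf: "\<And>u. u \<in> space U \<Longrightarrow> Map k (Map f u) = u"
    by (rule sspace_isomorphismE) blast
  \<comment> \<open>An element of the ideal \<open>J\<close> above \<open>s\<close> would force
    \<open>s\<close> into \<open>J\<close>. So the default branch of \<open>coind_ob\<close>, the
    whole ambient space, applies at \<open>s\<close>.\<close>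
  have "\<not> (\<exists>r \<in> J. s \<le> r)"
    using assms(1,4) by (auto simp: poset_ideal_def)
  then have "sub (coind_ob S J W) s = space (coind_ob S J W)"
    using assms(4) by (simp add: coind_ob_def)
  \<comment> \<open>Write \<open>u\<close> as \<open>Map k (Map f u)\<close>: the inner vector lies
    in the full component at \<open>s\<close>, and \<open>k\<close> carries that component into
    \<open>sub U s\<close>.\<close>
  then have "u \<in> sub U s" if "u \<in> space U" for u
    using sspace_homD(6)[OF f that] sspace_homD(5)[OF k, of s] kf[OF that] assms(4)
    by (metis DiffD1 image_subset_iff)
  then show ?thesis
    using sub_subset_space[OF assms(2)] assms(4) by blast
qed

text \<open>Parts (b) and (c) share one quantified block, with \<open>\<alpha>'\<close> bound by an
  equation so that both speak of the same morphism. In (c), the equality of the restriction of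
  \<open>V\<^sup>g\<close> with \<open>V\<close> makes \<open>\<alpha>\<close> an admissible input
  for the construction over \<open>V\<^sup>g\<close>.\<close>

theorem proposition2p17:
  fixes K :: "('k, 'e) ring_scheme"
    and S R :: "'s::order set"
    and U V :: "('k, 'v, 's) sspace"
    and g :: "('k, 'v, 's) sspace_mor"
  assumes "field K"
    and "finite S"
    and "poset_filter R S"
    and "U \<in> Ob (sspace_cat K S)"
    and "V \<in> Ob (sspace_cat K R)"
    and "g \<in> Hom (sspace_cat K R) (obmap (res R) U) V"
  shows
    "(up_space S R U g \<in> Ob (sspace_cat K S) \<and>
      up_mor S R U g \<in> Hom (sspace_cat K S) U (up_space S R U g) \<and>
      g = armap (res R) (up_mor S R U g) \<and>
      (proper R g \<longleftrightarrow> proper S (up_mor S R U g)) \<and>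
      (isomorphism (sspace_cat K R) (obmap (res R) U) V g \<longleftrightarrow>
       isomorphism (sspace_cat K S) U (up_space S R U g) (up_mor S R U g))) \<and>

     (\<forall>X Z h \<alpha> \<beta> \<alpha>'.
        X \<in> Ob (sspace_cat K S) \<longrightarrow>
        Z \<in> Ob (sspace_cat K R) \<longrightarrow>
        h \<in> Hom (sspace_cat K R) (obmap (res R) X) Z \<longrightarrow>
        \<alpha> \<in> Hom (sspace_cat K R) V Z \<longrightarrow>
        \<beta> \<in> Hom (sspace_cat K S) U X \<longrightarrow>
        Comp (sspace_cat K R) \<alpha> g = Comp (sspace_cat K R) h (armap (res R) \<beta>) \<longrightarrow>
        \<alpha>' = \<lparr>Dom = up_space S R U g, Cod = up_space S R X h, Map = Map \<alpha>\<rparr> \<longrightarrow>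
          (\<alpha>' \<in> Hom (sspace_cat K S) (up_space S R U g) (up_space S R X h) \<and>
           \<alpha> = armap (res R) \<alpha>' \<and>
           Comp (sspace_cat K S) (up_mor S R X h) \<beta> =
             Comp (sspace_cat K S) \<alpha>' (up_mor S R U g)) \<and>
          (isomorphism (sspace_cat K S) U X \<beta> \<longrightarrow>
           obmap (res R) (up_space S R U g) = V \<and>
           up_space S R X h = up_space S R (up_space S R U g) \<alpha> \<and>
           \<alpha>' = up_mor S R (up_space S R U g) \<alpha>)) \<and>

     left_quasi_full (sspace_cat K S)
       (sspace_cat K R :: (('k, 'v, 's) sspace, ('k, 'v, 's) sspace_mor) cat) (res R) \<and>

     (left_minimal (sspace_cat K R) V g \<longleftrightarrow>
      left_minimal (sspace_cat K S) (up_space S R U g) (up_mor S R U g)) \<and>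

     (\<forall>J W.
        poset_ideal J S \<longrightarrow>
        W \<in> Ob (sspace_cat K J) \<longrightarrow>
        isomorphic (sspace_cat K S) U (coind_ob S J W) \<longrightarrow>
          (\<forall>s \<in> R - J. Map g ` space U \<subseteq> sub (up_space S R U g) s) \<and>
          (\<forall>s \<in> S - (R \<union> J). sub (up_space S R U g) s = Map g ` space U))"
proof -
  note R = assms(3)
  have RS: "R \<subseteq> S" using R by (simp add: poset_filter_def)
  have U: "is_sspace K S U" and V: "is_sspace K R V" and g: "g \<in> sspace_hom K R (res_ob R U) V"
    using assms by simp_all
  note rs = res_up_space[OF RS V g]
  show ?thesis
  \<comment> \<open>Cases 1 to 5 are (a), 6 to 8 the square of (b), 9 to 11 (c), 12 left quasi
    fullness, 13 (d), and 14 and 15 (e).\<close>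
  proof (intro conjI allI impI ballI, goal_cases)
    case 1
    show ?case using is_sspace_up_space[OF R U V g] by simp
  next
    case 2
    show ?case using up_mor_hom[OF g, of S] by simp
  next
    case 3
    show ?case by (rule res_up_mor[OF RS V g, symmetric])
  next
    case 4
    show ?case by (rule proper_up_mor_iff[OF RS U g, symmetric])
  next
    case 5
    show ?case unfolding res_simps by (rule isomorphism_up_mor_iff[OF R U V g, symmetric])
  next
    case (6 X Z h \<alpha> \<beta> \<alpha>')
    show ?case
      using up_space_square(2)[OF U g 6(3-5)[unfolded sspace_cat_simps(2) res_simps(1)] 6(6)]
      unfolding 6(7) sspace_cat_simps(2) .
  next
    case (7 X Z h \<alpha> \<beta> \<alpha>')
    have h: "h \<in> sspace_hom K R (res_ob R X) Z" and Z: "is_sspace K R Z"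
      and \<alpha>: "\<alpha> \<in> sspace_hom K R V Z"
      using 7(2-4) by simp_all
    show ?case
      using sspace_homD(1,2)[OF \<alpha>] rs res_up_space[OF RS Z h] by (simp add: 7(7))
  next
    case (8 X Z h \<alpha> \<beta> \<alpha>')
    show ?case
      using up_space_square(3)[OF U g 8(3-5)[unfolded sspace_cat_simps(2) res_simps(1)] 8(6)]
      unfolding 8(7) .
  next
    case 9
    show ?case using rs by simp
  next
    case (10 X Z h \<alpha> \<beta> \<alpha>')
    show ?case
      using up_space_square_iso[OF U 10(1)[unfolded sspace_cat_simps(1)] g
          10(3,4)[unfolded sspace_cat_simps(2) res_simps(1)] 10(6,8)] .
  next
    case (11 X Z h \<alpha> \<beta> \<alpha>')
    show ?case
      using up_space_square_iso[OF U 11(1)[unfolded sspace_cat_simps(1)] g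
          11(3,4)[unfolded sspace_cat_simps(2) res_simps(1)] 11(6,8)]
      \<comment> \<open>Domain and linear map agree by definition, so the two morphisms coincide
        once their codomains do.\<close>
      unfolding 11(7) up_mor_def by (rule arg_cong)
  next
    case 12
    show ?case by (rule left_quasi_full_res[OF R])
  next
    case 13
    show ?case by (rule left_minimal_up_mor_iff[OF R U V g, symmetric])
  next
    case (14 J W s)
    then have "s \<in> R" "s \<in> S" "sub U s = space U"
      using RS sub_eq_space_if_isomorphic_coind[OF 14(1) U 14(3), of s] by auto
    \<comment> \<open>At an index \<open>s\<close> of \<open>R\<close> the morphism \<open>g\<close>
      maps \<open>U(s)\<close>, here all of \<open>U\<close>, into \<open>V(s)\<close>.\<close>
    then show ?case using sspace_homD(2,5)[OF g] by fastforce
  next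
    case (15 J W s)
    then show ?case
      using sub_eq_space_if_isomorphic_coind[OF 15(1) U 15(3), of s] by simp
  qed
qed

end
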